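(* Let $\mathcal{P}_1,\mathcal{P}_2$ be weakly ranked posets with kernels $\kappa_1,\kappa_2$, and let $\kappa=\kappa_1\otimes\kappa_2$ be the resulting kernel of $\mathcal{P}_1\times\mathcal{P}_2$. Let $H_1,H_2$ be the Chow functions of $(\mathcal{P}_1,\kappa_1)$ and $(\mathcal{P}_2,\kappa_2)$. Let $F_1,F_2,F$ be the right augmented Chow functions of $\mathcal{P}_1,\mathcal{P}_2,\mathcal{P}_1\times\mathcal{P}_2$ with respect to $\kappa_1,\kappa_2,\kappa$. Then $$F=F_1\otimes F_2+x(H_1\otimes H_2)\cdot F-x(I\otimes H_2)\cdot F-x(H_1\otimes I)\cdot F+xF.$$ Similarly, let $G_1,G_2,G$ be the left augmented Chow functions of $\mathcal{P}_1,\mathcal{P}_2,\mathcal{P}_1\times\mathcal{P}_2$ with respect to $\kappa_1,\kappa_2,\kappa$. Then $$G=G_1\otimes G_2+xG\cdot(H_1\otimes H_2)-xG\cdot(I\otimes H_2)-xG\cdot(H_1\otimes I)+xG.$$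
   Context: A weakly ranked poset is a (locally finite) poset $\mathcal{P}$ with a function $\mathrm{rk}$ assigning to each pair $s\le t$ (interval $[s,t]$) an integer $\mathrm{rk}(s,t)$ such that $\mathrm{rk}(s,t)>0$ if $s<t$, and $\mathrm{rk}(s,t)=\mathrm{rk}(s,u)+\mathrm{rk}(u,t)$ if $s\le u\le t$. The incidence algebra $\mathcal{J}(\mathcal{P})$ consists of the functions $a$ assigning to each $s\le t$ a polynomial $a_{s,t}\in\mathbb{Z}[x]$, with product $(a\cdot b)_{s,t}=\sum_{s\le u\le t}a_{s,u}b_{u,t}$; $I$ denotes the identity element. $\mathcal{J}_{\mathrm{rk}}(\mathcal{P})$ is the subalgebra of $a$ with $\deg a_{s,t}\le\mathrm{rk}(s,t)$. For $a\in\mathcal{J}_{\mathrm{rk}}(\mathcal{P})$, $(a^{\mathrm{rev}})_{s,t}=x^{\mathrm{rk}(s,t)}a_{s,t}(x^{-1})$. A kernel is an element $\kappa\in\mathcal{J}_{\mathrm{rk}}(\mathcal{P})$ with $\kappa_{s,s}=1$ for all $s$ and $\kappa^{-1}=\kappa^{\mathrm{rev}}$; then $x-1$ divides $\kappa_{s,t}$ for $s<t$. The reduced kernel $\overline\kappa$ is given by $\overline\kappa_{s,t}=\kappa_{s,t}/(x-1)$ for $s<t$ and $\overline\kappa_{s,s}=-1$. The Chow function of $(\mathcal{P},\kappa)$ is $H=-(\overline\kappa)^{-1}$. The right KLS function $f$ of $\kappa$ is the unique element of $\mathcal{J}_{\mathrm{rk}}(\mathcal{P})$ with $f_{s,s}=1$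 for all $s$, $\deg f_{s,t}<\mathrm{rk}(s,t)/2$ for $s<t$, and $f^{\mathrm{rev}}=\kappa\cdot f$. The left KLS function $g$ is the unique element of $\mathcal{J}_{\mathrm{rk}}(\mathcal{P})$ with $g_{s,s}=1$ for all $s$, $\deg g_{s,t}<\mathrm{rk}(s,t)/2$ for $s<t$, and $g^{\mathrm{rev}}=g\cdot\kappa$. The right augmented Chow function of $(\mathcal{P},\kappa)$ is $F=H\cdot f^{\mathrm{rev}}$; the left augmented Chow function is $G=g^{\mathrm{rev}}\cdot H$. $\mathcal{P}_1\times\mathcal{P}_2$ has the componentwise order and weak rank function $\mathrm{rk}((s_1,s_2),(t_1,t_2))=\mathrm{rk}_1(s_1,t_1)+\mathrm{rk}_2(s_2,t_2)$. For $a_i\in\mathcal{J}(\mathcal{P}_i)$, $a_1\otimes a_2\in\mathcal{J}(\mathcal{P}_1\times\mathcal{P}_2)$ is $(a_1\otimes a_2)_{(s_1,s_2),(t_1,t_2)}=(a_1)_{s_1,t_1}(a_2)_{s_2,t_2}$. In $I\otimes H_2$ (resp. $H_1\otimes I$), $I$ is the identity of $\mathcal{J}(\mathcal{P}_1)$ (resp. $\mathcal{J}(\mathcal{P}_2)$). *)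

theory Defs
  imports "HOL-Computational_Algebra.Polynomial" "HOL-Library.Product_Order"
begin

class locally_finite_order = order +
  assumes finite_interval: "finite {a..b}"

instance prod :: (locally_finite_order, locally_finite_order) locally_finite_order
proof
  fix a b :: "'a \<times> 'b"
  have "{a..b} \<subseteq> {fst a..fst b} \<times> {snd a..snd b}"
    by (auto simp: less_eq_prod_def)
  then show "finite {a..b}"
    by (rule finite_subset) (simp add: finite_interval)
qed

definition weak_rank :: "('a::order \<Rightarrow> 'a \<Rightarrow> int) \<Rightarrow> bool" where
  "weak_rank rk \<longleftrightarrow>
     (\<forall>s t. s < t \<longrightarrow> 0 < rk s t) \<and>
     (\<forall>s u t. s \<le> u \<longrightarrow> u \<le> t \<longrightarrow> rk s t = rk s u + rk u t)"

(* An element of the incidence algebra is a function on the pairs s \<le> t; it is extended by 0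
   to all pairs, so that equality of elements is equality on the pairs s \<le> t. *)
typedef (overloaded) 'a incidence =
  "{a :: 'a::order \<Rightarrow> 'a \<Rightarrow> int poly. \<forall>s t. \<not> s \<le> t \<longrightarrow> a s t = 0}"
  morphisms entry Abs_incidence
  by (rule exI[of _ "\<lambda>_ _. 0"]) simp

setup_lifting type_definition_incidence

instantiation incidence :: (order) ab_group_add
begin

lift_definition zero_incidence :: "'a incidence" is "\<lambda>_ _. 0" by simp
lift_definition plus_incidence :: "'a incidence \<Rightarrow> 'a incidence \<Rightarrow> 'a incidence"
  is "\<lambda>a b s t. a s t + b s t" by simp
lift_definition uminus_incidence :: "'a incidence \<Rightarrow> 'a incidence"
  is "\<lambda>a s t. - a s t" by simp
lift_definition minus_incidence :: "'a incidence \<Rightarrow> 'a incidence \<Rightarrow> 'a incidence"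
  is "\<lambda>a b s t. a s t - b s t" by simp

instance
  by standard (transfer; simp add: fun_eq_iff algebra_simps)+

end

instantiation incidence :: (locally_finite_order) ring_1
begin

lift_definition one_incidence :: "'a incidence" is "\<lambda>s t. if s = t then 1 else 0" by auto
lift_definition times_incidence :: "'a incidence \<Rightarrow> 'a incidence \<Rightarrow> 'a incidence"
  is "\<lambda>a b s t. \<Sum>u\<in>{s..t}. a s u * b u t" by simp

instance
proof
  fix a b c :: "'a incidence"
  show "a * b * c = a * (b * c)"
  proof (transfer, intro ext)
    fix a b c :: "'a \<Rightarrow> 'a \<Rightarrow> int poly" and s t
    have "(\<Sum>u\<in>{s..t}. (\<Sum>v\<in>{s..u}. a s v * b v u) * c u t)
        = (\<Sum>u\<in>{s..t}. \<Sum>v\<in>{v\<in>{s..t}. v \<le> u}. a s v * b v u * c u t)"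
      by (intro sum.cong refl) (auto simp: sum_distrib_right intro!: sum.cong)
    also have "\<dots> = (\<Sum>v\<in>{s..t}. \<Sum>u\<in>{u\<in>{s..t}. v \<le> u}. a s v * b v u * c u t)"
      by (rule sum.swap_restrict) (simp_all add: finite_interval)
    also have "\<dots> = (\<Sum>v\<in>{s..t}. a s v * (\<Sum>u\<in>{v..t}. b v u * c u t))"
      by (intro sum.cong refl) (auto simp: sum_distrib_left mult.assoc intro!: sum.cong)
    finally show "(\<Sum>u\<in>{s..t}. (\<Sum>v\<in>{s..u}. a s v * b v u) * c u t)
        = (\<Sum>v\<in>{s..t}. a s v * (\<Sum>u\<in>{v..t}. b v u * c u t))" .
  qed
  show "1 * a = a"
  proof (transfer, intro ext)
    fix a :: "'a \<Rightarrow> 'a \<Rightarrow> int poly" and s t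
    assume "\<forall>s t. \<not> s \<le> t \<longrightarrow> a s t = 0"
    then show "(\<Sum>u\<in>{s..t}. (if s = u then 1 else 0) * a u t) = a s t"
      by (simp add: if_distrib[of "\<lambda>x. x * _"] sum.delta finite_interval cong: if_cong)
  qed
  show "a * 1 = a"
  proof (transfer, intro ext)
    fix a :: "'a \<Rightarrow> 'a \<Rightarrow> int poly" and s t
    assume "\<forall>s t. \<not> s \<le> t \<longrightarrow> a s t = 0"
    then show "(\<Sum>u\<in>{s..t}. a s u * (if u = t then 1 else 0)) = a s t"
      by (simp add: if_distrib[of "\<lambda>x. _ * x"] sum.delta' finite_interval cong: if_cong)
  qed
  show "(a + b) * c = a * c + b * c" "a * (b + c) = a * b + a * c"
    by (transfer; simp add: fun_eq_iff algebra_simps sum.distrib)+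
  show "(0 :: 'a incidence) \<noteq> 1"
    by transfer (auto simp: fun_eq_iff)
qed

end

lifting_forget poly.lifting

lift_definition scale :: "int poly \<Rightarrow> 'a::order incidence \<Rightarrow> 'a incidence" (infixr "\<odot>" 70)
  is "\<lambda>p a s t. p * a s t" by simp

lift_definition tensor ::
  "'a::order incidence \<Rightarrow> 'b::order incidence \<Rightarrow> ('a \<times> 'b) incidence" (infixl "\<otimes>" 75)
  is "\<lambda>a b s t. a (fst s) (fst t) * b (snd s) (snd t)"
  by (auto simp: less_eq_prod_def)

definition prod_rank ::
  "('a \<Rightarrow> 'a \<Rightarrow> int) \<Rightarrow> ('b \<Rightarrow> 'b \<Rightarrow> int) \<Rightarrow> 'a \<times> 'b \<Rightarrow> 'a \<times> 'b \<Rightarrow> int" where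
  "prod_rank rk1 rk2 s t = rk1 (fst s) (fst t) + rk2 (snd s) (snd t)"

definition bounded_incidence :: "('a::order \<Rightarrow> 'a \<Rightarrow> int) \<Rightarrow> 'a incidence set" where
  "bounded_incidence rk = {a. \<forall>s t. s \<le> t \<longrightarrow> int (degree (entry a s t)) \<le> rk s t}"

(* Coefficientwise form of x^rk(s,t) * a_{s,t}(1/x); it agrees with it on bounded_incidence rk,
   the only place where the reversal is used. *)
lift_definition rev_incidence ::
  "('a::order \<Rightarrow> 'a \<Rightarrow> int) \<Rightarrow> 'a incidence \<Rightarrow> 'a incidence"
  is "\<lambda>rk a s t. \<Sum>i\<le>nat (rk s t). monom (coeff (a s t) i) (nat (rk s t) - i)"
  by simp

definition inverse_incidence :: "'a::locally_finite_order incidence \<Rightarrow> 'a incidence" where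
  "inverse_incidence a = (THE b. a * b = 1 \<and> b * a = 1)"

definition is_kernel ::
  "('a::locally_finite_order \<Rightarrow> 'a \<Rightarrow> int) \<Rightarrow> 'a incidence \<Rightarrow> bool" where
  "is_kernel rk \<kappa> \<longleftrightarrow>
     \<kappa> \<in> bounded_incidence rk \<and> (\<forall>s. entry \<kappa> s s = 1) \<and>
     \<kappa> * rev_incidence rk \<kappa> = 1 \<and> rev_incidence rk \<kappa> * \<kappa> = 1"

(* For a kernel the division by x - 1 = [:-1, 1:] is exact. *)
lift_definition reduced_kernel :: "'a::order incidence \<Rightarrow> 'a incidence"
  is "\<lambda>\<kappa> s t. if s = t then - 1 else \<kappa> s t div [:- 1, 1:]"
  by auto

definition chow :: "'a::locally_finite_order incidence \<Rightarrow> 'a incidence" where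
  "chow \<kappa> = - inverse_incidence (reduced_kernel \<kappa>)"

definition right_KLS ::
  "('a::locally_finite_order \<Rightarrow> 'a \<Rightarrow> int) \<Rightarrow> 'a incidence \<Rightarrow> 'a incidence" where
  "right_KLS rk \<kappa> = (THE f. f \<in> bounded_incidence rk \<and> (\<forall>s. entry f s s = 1) \<and>
     (\<forall>s t. s < t \<longrightarrow> 2 * int (degree (entry f s t)) < rk s t) \<and>
     rev_incidence rk f = \<kappa> * f)"

definition left_KLS ::
  "('a::locally_finite_order \<Rightarrow> 'a \<Rightarrow> int) \<Rightarrow> 'a incidence \<Rightarrow> 'a incidence" where
  "left_KLS rk \<kappa> = (THE g. g \<in> bounded_incidence rk \<and> (\<forall>s. entry g s s = 1) \<and>
     (\<forall>s t. s < t \<longrightarrow> 2 * int (degree (entry g s t)) < rk s t) \<and>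
     rev_incidence rk g = g * \<kappa>)"

definition right_augmented_chow ::
  "('a::locally_finite_order \<Rightarrow> 'a \<Rightarrow> int) \<Rightarrow> 'a incidence \<Rightarrow> 'a incidence" where
  "right_augmented_chow rk \<kappa> = chow \<kappa> * rev_incidence rk (right_KLS rk \<kappa>)"

definition left_augmented_chow ::
  "('a::locally_finite_order \<Rightarrow> 'a \<Rightarrow> int) \<Rightarrow> 'a incidence \<Rightarrow> 'a incidence" where
  "left_augmented_chow rk \<kappa> = rev_incidence rk (left_KLS rk \<kappa>) * chow \<kappa>"

end

theory Submission
  imports Defs
begin

text \<open>Write \<open>\<kappa>bar\<close> for the reduced kernel and \<open>rev\<close> for the reversal. By definition
  \<open>H \<kappa>bar = \<kappa>bar H = -1\<close>, so that \<open>F = H f\<^sup>r\<^sup>e\<^sup>v\<close> means \<open>f\<^sup>r\<^sup>e\<^sup>v = - \<kappa>bar F\<close>. The function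
  \<open>f\<^sub>1 \<otimes> f\<^sub>2\<close> satisfies the conditions that characterize the right KLS function of
  \<open>\<kappa>\<^sub>1 \<otimes> \<kappa>\<^sub>2\<close>, whence \<open>f\<^sup>r\<^sup>e\<^sup>v = f\<^sub>1\<^sup>r\<^sup>e\<^sup>v \<otimes> f\<^sub>2\<^sup>r\<^sup>e\<^sup>v\<close> (\<open>rev_right_KLS_tensor\<close>). Therefore
  \<open>F\<^sub>1 \<otimes> F\<^sub>2 = (H\<^sub>1 \<otimes> H\<^sub>2) f\<^sup>r\<^sup>e\<^sup>v = - (H\<^sub>1 \<otimes> H\<^sub>2) \<kappa>bar F\<close>, and the theorem reduces to computing
  \<open>(H\<^sub>1 \<otimes> H\<^sub>2) \<kappa>bar\<close>.

  For this, \<open>(x - 1) \<kappa>bar = \<kappa> - x\<close>: off the diagonal this is the definition of \<open>\<kappa>bar\<close>, and the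
  value \<open>-1\<close> on the diagonal is chosen to make it true there. Multiplying by \<open>H\<close> gives
  \<open>H \<kappa> = \<kappa> H = x H + (1 - x)\<close> (\<open>kernel_chow\<close>). Applied in both factors, this turns
  \<open>(H\<^sub>1 \<otimes> H\<^sub>2) (\<kappa>\<^sub>1 \<otimes> \<kappa>\<^sub>2 - x)\<close> into a combination of \<open>H\<^sub>1 \<otimes> H\<^sub>2\<close>, \<open>I \<otimes> H\<^sub>2\<close>, \<open>H\<^sub>1 \<otimes> I\<close> and \<open>I\<close>
  that is divisible by \<open>x - 1\<close> (\<open>chow_tensor_reduced_kernel\<close>). The left identity is obtained in
  the same way with \<open>\<kappa>bar (H\<^sub>1 \<otimes> H\<^sub>2)\<close>.

  The argument presupposes that \<open>\<kappa>bar\<close> is invertible, that \<open>x - 1\<close> divides the entries of a kernel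
  above the diagonal (\<open>kernel_dvd\<close>), and that KLS functions exist and are unique. All three rest
  on recursion over the intervals \<open>[s, t]\<close> with \<open>t\<close> fixed; left KLS functions are obtained as
  inverses of right ones (\<open>left_KLS_iff_inverse_right_KLS\<close>).\<close>

section \<open>Entries and intervals\<close>

lemma entry_eq_0 [simp]: "\<not> s \<le> t \<Longrightarrow> entry a s t = 0"
  by transfer simp

lemma incidence_eqI:
  assumes "\<And>s t. s \<le> t \<Longrightarrow> entry a s t = entry b s t"
  shows "a = b"
proof -
  have "entry a s t = entry b s t" for s t
    using assms by (cases "s \<le> t") simp_all
  then show ?thesis by (simp add: fun_eq_iff flip: entry_inject)
qed

lemma entry_arith [simp]:
  "entry 0 s t = 0" "entry (a + b) s t = entry a s t + entry b s t"
  "entry (a - b) s t = entry a s t - entry b s t" "entry (- a) s t = - entry a s t"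
  "entry (p \<odot> a) s t = p * entry a s t"
  by (transfer; simp)+

lemma entry_tensor [simp]:
  "entry (a \<otimes> b) s t = entry a (fst s) (fst t) * entry b (snd s) (snd t)"
  by transfer simp

lemma entry_one: "entry 1 s t = (if s = t then 1 else 0)"
  by transfer simp

lemma entry_mult: "entry (a * b) s t = (\<Sum>u\<in>{s..t}. entry a s u * entry b u t)"
  by transfer simp

lemma entry_mult_diag [simp]: "entry (a * b) s s = entry a s s * entry b s s"
  by (simp add: entry_mult)

lemma finite_half_open_interval: "finite {s<..t}" for s t :: "'a::locally_finite_order"
  by (rule finite_subset[OF _ finite_interval[of s t]]) auto

lemma entry_mult_first:
  fixes a b :: "'a::locally_finite_order incidence"
  assumes "s \<le> t"
  shows "entry (a * b) s t =
    entry a s s * entry b s t + (\<Sum>u\<in>{s<..t}. entry a s u * entry b u t)"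
proof -
  have "{s..t} = insert s {s<..t}" using assms by auto
  then show ?thesis by (simp add: entry_mult finite_half_open_interval)
qed

lemma card_interval_less:
  fixes s t u :: "'a::locally_finite_order"
  assumes "s < u" "u \<le> t"
  shows "card {u..t} < card {s..t}"
  using assms by (intro psubset_card_mono finite_interval) auto

lemma interval_induct [consumes 1, case_names step]:
  fixes s t :: "'a::locally_finite_order"
  assumes "s \<le> t"
    and step: "\<And>s. s \<le> t \<Longrightarrow> (\<And>u. s < u \<Longrightarrow> u \<le> t \<Longrightarrow> P u) \<Longrightarrow> P s"
  shows "P s"
  using \<open>s \<le> t\<close>
proof (induction "card {s..t}" arbitrary: s rule: less_induct)
  case (less s)
  show ?case
  proof (rule step)
    show "s \<le> t" by fact
    show "P u" if "s < u" "u \<le> t" for u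
      using less.hyps[OF card_interval_less[OF that] that(2)] .
  qed
qed

section \<open>Triangular recursion and inverses\<close>

text \<open>Both inverses and Kazhdan-Lusztig-Stanley functions are found one entry at a time: the
  remainder of the product with \<open>a\<close> involves only the intervals \<open>[u, t]\<close> with \<open>s < u\<close>, and
  \<open>T s t\<close> turns that remainder into the entry at \<open>[s, t]\<close>. Keeping \<open>T\<close> as a parameter lets one
  recursion serve both purposes.\<close>

function triangular_solution ::
  "('a::locally_finite_order \<Rightarrow> 'a \<Rightarrow> int poly \<Rightarrow> int poly) \<Rightarrow> 'a incidence \<Rightarrow> 'a \<Rightarrow> 'a \<Rightarrow> int poly"
where
  "triangular_solution T a s t =
    (if s = t then 1
     else if s \<le> t then T s t (\<Sum>u\<in>{s<..t}. entry a s u * triangular_solution T a u t)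
     else 0)"
  by auto
termination
  by (relation "measure (\<lambda>(T, a, s, t). card {s..t})") (auto simp: card_interval_less)

declare triangular_solution.simps [simp del]

lemma triangular_solution_exists:
  fixes a :: "'a::locally_finite_order incidence"
  obtains b where "\<And>s. entry b s s = 1"
    and "\<And>s t. s < t \<Longrightarrow> entry b s t = T s t (\<Sum>u\<in>{s<..t}. entry a s u * entry b u t)"
proof -
  define b where "b = Abs_incidence (triangular_solution T a)"
  have "entry b = triangular_solution T a"
    unfolding b_def by (rule Abs_incidence_inverse) (auto simp: triangular_solution.simps)
  moreover have "triangular_solution T a s s = 1" for s
    by (simp add: triangular_solution.simps)
  moreover have "triangular_solution T a s t =
      T s t (\<Sum>u\<in>{s<..t}. entry a s u * triangular_solution T a u t)" if "s < t" for s t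
    using that by (subst triangular_solution.simps) auto
  ultimately show ?thesis by (intro that[of b]) auto
qed

lemma unitriangular_right_inverse:
  fixes a :: "'a::locally_finite_order incidence"
  assumes "\<And>s. entry a s s = 1"
  obtains b where "\<And>s. entry b s s = 1" and "a * b = 1"
proof -
  obtain b where b: "\<And>s. entry b s s = 1"
    "\<And>s t. s < t \<Longrightarrow> entry b s t = - (\<Sum>u\<in>{s<..t}. entry a s u * entry b u t)"
    using triangular_solution_exists[of "\<lambda>_ _ q. - q" a] by blast
  have "a * b = 1"
  proof (rule incidence_eqI)
    fix s t :: 'a assume "s \<le> t"
    then show "entry (a * b) s t = entry 1 s t"
      using assms b by (cases "s = t") (auto simp: entry_one entry_mult_first)
  qed
  with b(1) that show ?thesis by blast
qed

lemma unitriangular_inverse: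
  fixes a :: "'a::locally_finite_order incidence"
  assumes "\<And>s. entry a s s = 1"
  obtains b where "\<And>s. entry b s s = 1" and "a * b = 1" and "b * a = 1"
proof -
  obtain b where b: "\<And>s. entry b s s = 1" "a * b = 1"
    using unitriangular_right_inverse[OF assms] by blast
  obtain c where c: "b * c = 1"
    using unitriangular_right_inverse[OF b(1)] by blast
  have "a = a * (b * c)" using c by simp
  also have "\<dots> = c" using b(2) by (simp flip: mult.assoc)
  finally have "b * a = 1" using c by simp
  with b that show ?thesis by blast
qed

lemma inverse_incidence_eq:
  assumes "a * b = 1" "b * a = 1"
  shows "inverse_incidence a = b"
  unfolding inverse_incidence_def
proof (rule the_equality)
  fix c assume c: "a * c = 1 \<and> c * a = 1"
  have "c = (b * a) * c" using assms by simp
  then show "c = b" using c by (simp add: mult.assoc)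
qed (use assms in simp)

section \<open>Scalars and tensor products\<close>

lemma scale_mult [simp]:
  "(p \<odot> a) * b = p \<odot> (a * b)" "a * (p \<odot> b) = p \<odot> (a * b)"
  by (rule incidence_eqI; simp add: entry_mult sum_distrib_left mult_ac)+

lemma scale_left_cancel:
  assumes "p \<odot> a = p \<odot> b" "p \<noteq> 0"
  shows "a = b"
proof (rule incidence_eqI)
  fix s t
  have "p * entry a s t = p * entry b s t"
    using arg_cong[OF assms(1), of "\<lambda>c. entry c s t"] by simp
  with assms(2) show "entry a s t = entry b s t" by simp
qed

lemma tensor_mult: "(a \<otimes> b) * (c \<otimes> d) = (a * c) \<otimes> (b * d)"
proof (rule incidence_eqI)
  fix s t :: "'a \<times> 'b"
  have "{s..t} = {fst s..fst t} \<times> {snd s..snd t}"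
    by (auto simp: less_eq_prod_def)
  then show "entry ((a \<otimes> b) * (c \<otimes> d)) s t = entry ((a * c) \<otimes> (b * d)) s t"
    by (simp add: entry_mult sum_product sum.cartesian_product case_prod_beta mult_ac)
qed

lemma tensor_one: "1 \<otimes> 1 = 1"
  by (rule incidence_eqI) (auto simp: entry_one prod_eq_iff)

section \<open>Reversal\<close>

text \<open>In contrast to \<open>reflect_poly\<close>, the length \<open>n\<close> is prescribed and may exceed the degree; this
  makes reversal additive, and multiplicative when lengths are added.\<close>

definition reverse_poly :: "nat \<Rightarrow> int poly \<Rightarrow> int poly" where
  "reverse_poly n p = (\<Sum>i\<le>n. monom (coeff p i) (n - i))"

lemma entry_rev:
  "entry (rev_incidence rk a) s t = reverse_poly (nat (rk s t)) (entry a s t)"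
  unfolding reverse_poly_def by transfer simp

lemma coeff_reverse_poly:
  "coeff (reverse_poly n p) j = (if j \<le> n then coeff p (n - j) else 0)"
proof -
  have "coeff (reverse_poly n p) j = (\<Sum>i\<le>n. if n - i = j then coeff p i else 0)"
    by (simp add: reverse_poly_def coeff_sum)
  also have "\<dots> = (\<Sum>i\<le>n. if i = n - j then (if j \<le> n then coeff p (n - j) else 0) else 0)"
    by (intro sum.cong) auto
  also have "\<dots> = (if j \<le> n then coeff p (n - j) else 0)" by simp
  finally show ?thesis .
qed

lemma degree_reverse_poly: "degree (reverse_poly n p) \<le> n"
  by (rule degree_le) (simp add: coeff_reverse_poly)

lemma reverse_poly_add: "reverse_poly n (p + q) = reverse_poly n p + reverse_poly n q"
  by (rule poly_eqI) (simp add: coeff_reverse_poly)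

lemma reverse_poly_0 [simp]: "reverse_poly n 0 = 0"
  by (rule poly_eqI) (simp add: coeff_reverse_poly)

lemma reverse_poly_sum: "reverse_poly n (\<Sum>i\<in>A. p i) = (\<Sum>i\<in>A. reverse_poly n (p i))"
  by (induction A rule: infinite_finite_induct) (simp_all add: reverse_poly_add)

lemma reverse_poly_one [simp]: "reverse_poly 0 1 = 1"
  by (simp add: reverse_poly_def)

lemma reverse_poly_reverse_poly:
  assumes "degree p \<le> n"
  shows "reverse_poly n (reverse_poly n p) = p"
  using assms by (intro poly_eqI) (auto simp: coeff_reverse_poly coeff_eq_0)

lemma reverse_poly_eq_reflect_poly:
  assumes "degree p \<le> n"
  shows "reverse_poly n p = monom 1 (n - degree p) * reflect_poly p"
proof (rule poly_eqI)
  fix j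
  show "coeff (reverse_poly n p) j = coeff (monom 1 (n - degree p) * reflect_poly p) j"
  proof (cases "n - degree p \<le> j \<and> j \<le> n")
    case True
    with assms have "degree p - (j - (n - degree p)) = n - j" "j - (n - degree p) \<le> degree p"
      by linarith+
    with True show ?thesis by (simp add: coeff_reverse_poly coeff_monom_mult coeff_reflect_poly)
  next
    case False
    with assms have "n < j \<and> degree p < j - (n - degree p) \<or> j < n - degree p \<and> degree p < n - j"
      by linarith
    then show ?thesis
      by (auto simp: coeff_reverse_poly coeff_monom_mult coeff_reflect_poly coeff_eq_0)
  qed
qed

lemma reverse_poly_mult:
  assumes "degree p \<le> m" "degree q \<le> n"
  shows "reverse_poly (m + n) (p * q) = reverse_poly m p * reverse_poly n q"
proof (cases "p = 0 \<or> q = 0")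
  case False
  have "degree (p * q) = degree p + degree q"
    using False by (simp add: degree_mult_eq)
  moreover have "monom 1 (m + n - (degree p + degree q)) =
      monom 1 (m - degree p) * monom (1 :: int) (n - degree q)"
    using assms by (simp add: mult_monom)
  ultimately show ?thesis
    using assms
    by (simp add: reverse_poly_eq_reflect_poly reflect_poly_mult mult_ac)
qed auto

lemma poly_reverse_poly_1:
  assumes "degree p \<le> n"
  shows "poly (reverse_poly n p) 1 = poly p 1"
proof -
  have "poly (reverse_poly n p) 1 = (\<Sum>i\<le>n. coeff p i)"
    by (simp add: reverse_poly_def poly_sum poly_monom)
  also have "\<dots> = poly p 1"
    using assms unfolding poly_altdef by (intro sum.mono_neutral_cong_right) (auto simp: coeff_eq_0)
  finally show ?thesis .
qed

section \<open>Weak ranks and bounded elements\<close>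

lemma weak_rankD:
  assumes "weak_rank rk"
  shows weak_rank_pos: "s < t \<Longrightarrow> 0 < rk s t"
    and weak_rank_add: "s \<le> u \<Longrightarrow> u \<le> t \<Longrightarrow> rk s t = rk s u + rk u t"
    and weak_rank_refl: "rk s s = 0"
proof -
  show "s < t \<Longrightarrow> 0 < rk s t"
    using assms unfolding weak_rank_def by blast
  have add: "s \<le> u \<Longrightarrow> u \<le> t \<Longrightarrow> rk s t = rk s u + rk u t" for s u t
    using assms unfolding weak_rank_def by blast
  then show "s \<le> u \<Longrightarrow> u \<le> t \<Longrightarrow> rk s t = rk s u + rk u t" .
  show "rk s s = 0" using add[of s s s] by simp
qed

lemma weak_rank_nonneg:
  assumes "weak_rank rk" "s \<le> t"
  shows "0 \<le> rk s t"
proof (cases "s = t")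
  case True
  then show ?thesis by (simp add: weak_rank_refl[OF assms(1)])
next
  case False
  with assms(2) show ?thesis using weak_rank_pos[OF assms(1), of s t] by (simp add: less_le)
qed

lemma weak_rank_prod:
  assumes "weak_rank rk1" "weak_rank rk2"
  shows "weak_rank (prod_rank rk1 rk2)"
  unfolding weak_rank_def prod_rank_def
proof (intro conjI allI impI)
  fix s t :: "'a \<times> 'b" assume st: "s < t"
  then consider "fst s < fst t" "snd s \<le> snd t" | "fst s \<le> fst t" "snd s < snd t"
    by (force simp: less_prod_def less_eq_prod_def less_le_not_le)
  then show "0 < rk1 (fst s) (fst t) + rk2 (snd s) (snd t)"
  proof cases
    case 1
    then show ?thesis
      by (intro add_pos_nonneg weak_rank_pos[OF assms(1)] weak_rank_nonneg[OF assms(2)])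
  next
    case 2
    then show ?thesis
      by (intro add_nonneg_pos weak_rank_nonneg[OF assms(1)] weak_rank_pos[OF assms(2)])
  qed
next
  fix s u t :: "'a \<times> 'b" assume "s \<le> u" "u \<le> t"
  then show "rk1 (fst s) (fst t) + rk2 (snd s) (snd t) =
     rk1 (fst s) (fst u) + rk2 (snd s) (snd u) + (rk1 (fst u) (fst t) + rk2 (snd u) (snd t))"
    using weak_rank_add[OF assms(1), of "fst s" "fst u" "fst t"]
      weak_rank_add[OF assms(2), of "snd s" "snd u" "snd t"]
    by (simp add: less_eq_prod_def)
qed

lemma degree_bounded:
  assumes "a \<in> bounded_incidence rk" "s \<le> t"
  shows "degree (entry a s t) \<le> nat (rk s t)"
proof -
  have "int (degree (entry a s t)) \<le> rk s t"
    using assms by (simp add: bounded_incidence_def)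
  then show ?thesis by linarith
qed

lemma nat_rank_add:
  assumes "weak_rank rk" "s \<le> u" "u \<le> t"
  shows "nat (rk s t) = nat (rk s u) + nat (rk u t)"
  using weak_rank_add[OF assms] weak_rank_nonneg[OF assms(1)] assms(2,3)
  by (simp add: nat_add_distrib)

lemma reverse_entry_mult:
  assumes "weak_rank rk" "a \<in> bounded_incidence rk" "b \<in> bounded_incidence rk" "s \<le> u" "u \<le> t"
  shows "reverse_poly (nat (rk s t)) (entry a s u * entry b u t) =
    entry (rev_incidence rk a) s u * entry (rev_incidence rk b) u t"
  using assms
  by (simp add: nat_rank_add[OF assms(1,4,5)] reverse_poly_mult degree_bounded entry_rev)

lemma rev_mult:
  fixes a b :: "'a::locally_finite_order incidence"
  assumes "weak_rank rk" "a \<in> bounded_incidence rk" "b \<in> bounded_incidence rk"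
  shows "rev_incidence rk (a * b) = rev_incidence rk a * rev_incidence rk b"
proof (rule incidence_eqI)
  fix s t :: 'a assume "s \<le> t"
  have "entry (rev_incidence rk (a * b)) s t =
      (\<Sum>u\<in>{s..t}. reverse_poly (nat (rk s t)) (entry a s u * entry b u t))"
    by (simp add: entry_rev entry_mult reverse_poly_sum)
  also have "\<dots> = entry (rev_incidence rk a * rev_incidence rk b) s t"
    unfolding entry_mult by (intro sum.cong refl reverse_entry_mult[OF assms]) auto
  finally show "entry (rev_incidence rk (a * b)) s t =
    entry (rev_incidence rk a * rev_incidence rk b) s t" .
qed

lemma rev_one:
  assumes "weak_rank rk"
  shows "rev_incidence rk 1 = 1"
  by (rule incidence_eqI) (simp add: entry_rev entry_one weak_rank_refl[OF assms])

lemma rev_diag: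
  assumes "weak_rank rk" "entry a s s = 1"
  shows "entry (rev_incidence rk a) s s = 1"
  by (simp add: entry_rev weak_rank_refl[OF assms(1)] assms(2))

lemma rev_bounded:
  fixes a :: "'a::order incidence"
  assumes "weak_rank rk"
  shows "rev_incidence rk a \<in> bounded_incidence rk"
  unfolding bounded_incidence_def
proof (intro CollectI allI impI)
  fix s t :: 'a assume "s \<le> t"
  then show "int (degree (entry (rev_incidence rk a) s t)) \<le> rk s t"
    using degree_reverse_poly[of "nat (rk s t)" "entry a s t"] weak_rank_nonneg[OF assms, of s t]
    by (simp add: entry_rev)
qed

lemma rev_rev:
  assumes "a \<in> bounded_incidence rk"
  shows "rev_incidence rk (rev_incidence rk a) = a"
  by (rule incidence_eqI) (simp add: entry_rev reverse_poly_reverse_poly degree_bounded[OF assms])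

lemma tensor_bounded:
  assumes "a \<in> bounded_incidence rk1" "b \<in> bounded_incidence rk2"
  shows "a \<otimes> b \<in> bounded_incidence (prod_rank rk1 rk2)"
  unfolding bounded_incidence_def
proof (intro CollectI allI impI)
  fix s t :: "'a \<times> 'b" assume "s \<le> t"
  then have "int (degree (entry a (fst s) (fst t))) \<le> rk1 (fst s) (fst t)"
    "int (degree (entry b (snd s) (snd t))) \<le> rk2 (snd s) (snd t)"
    using assms by (auto simp: bounded_incidence_def less_eq_prod_def)
  then show "int (degree (entry (a \<otimes> b) s t)) \<le> prod_rank rk1 rk2 s t"
    using degree_mult_le[of "entry a (fst s) (fst t)" "entry b (snd s) (snd t)"]
    by (simp add: prod_rank_def)
qed

lemma rev_tensor:
  assumes "weak_rank rk1" "weak_rank rk2"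
    and "a \<in> bounded_incidence rk1" "b \<in> bounded_incidence rk2"
  shows "rev_incidence (prod_rank rk1 rk2) (a \<otimes> b) = rev_incidence rk1 a \<otimes> rev_incidence rk2 b"
proof (rule incidence_eqI)
  fix s t :: "'a \<times> 'b" assume "s \<le> t"
  then have le: "fst s \<le> fst t" "snd s \<le> snd t" by (auto simp: less_eq_prod_def)
  have "nat (prod_rank rk1 rk2 s t) = nat (rk1 (fst s) (fst t)) + nat (rk2 (snd s) (snd t))"
    using weak_rank_nonneg[OF assms(1) le(1)] weak_rank_nonneg[OF assms(2) le(2)]
    by (simp add: prod_rank_def nat_add_distrib)
  then show "entry (rev_incidence (prod_rank rk1 rk2) (a \<otimes> b)) s t =
      entry (rev_incidence rk1 a \<otimes> rev_incidence rk2 b) s t"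
    using assms le by (simp add: entry_rev reverse_poly_mult degree_bounded)
qed

section \<open>Kernels and Chow functions\<close>

lemma is_kernelD:
  assumes "is_kernel rk \<kappa>"
  shows kernel_bounded: "\<kappa> \<in> bounded_incidence rk"
    and kernel_diag: "entry \<kappa> s s = 1"
    and kernel_rev: "\<kappa> * rev_incidence rk \<kappa> = 1" "rev_incidence rk \<kappa> * \<kappa> = 1"
  using assms by (auto simp: is_kernel_def)

lemma kernel_rev_incidence:
  assumes "weak_rank rk" "is_kernel rk \<kappa>"
  shows "is_kernel rk (rev_incidence rk \<kappa>)"
  using is_kernelD[OF assms(2)]
  by (simp add: is_kernel_def rev_rev rev_bounded[OF assms(1)] rev_diag[OF assms(1)])

lemma kernel_tensor:
  assumes "weak_rank rk1" "weak_rank rk2" "is_kernel rk1 \<kappa>1" "is_kernel rk2 \<kappa>2"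
  shows "is_kernel (prod_rank rk1 rk2) (\<kappa>1 \<otimes> \<kappa>2)"
  using is_kernelD[OF assms(3)] is_kernelD[OF assms(4)]
  by (simp add: is_kernel_def tensor_bounded rev_tensor assms tensor_mult tensor_one)

text \<open>At \<open>x = 1\<close> reversal does nothing, so the matrix \<open>\<kappa>(1)\<close> is unitriangular with square \<open>1\<close>.
  In characteristic zero this makes it the identity: inductively, only the two extreme terms
  of the square survive, and they give \<open>2 \<kappa>\<^sub>s\<^sub>,\<^sub>t(1) = 0\<close>.\<close>

lemma kernel_dvd:
  assumes "weak_rank rk" "is_kernel rk \<kappa>" "s < t"
  shows "[:- 1, 1:] dvd entry \<kappa> s t"
proof -
  note k = is_kernelD[OF assms(2)]
  have at1: "poly (entry (rev_incidence rk \<kappa>) u v) 1 = poly (entry \<kappa> u v) 1" for u v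
    by (cases "u \<le> v") (simp_all add: entry_rev poly_reverse_poly_1 degree_bounded[OF k(1)])
  have "s \<le> t" using assms(3) by simp
  then have "s \<noteq> t \<longrightarrow> poly (entry \<kappa> s t) 1 = 0"
  proof (induction rule: interval_induct)
    case (step s)
    show ?case
    proof
      assume "s \<noteq> t"
      have "0 = poly (entry (\<kappa> * rev_incidence rk \<kappa>) s t) 1"
        using k(3) \<open>s \<noteq> t\<close> by (simp add: entry_one)
      also have "\<dots> = poly (entry \<kappa> s t) 1 +
          (\<Sum>u\<in>{s<..t}. poly (entry \<kappa> s u) 1 * poly (entry \<kappa> u t) 1)"
        by (simp add: entry_mult_first[OF step.hyps] k(2) poly_sum at1)
      also have "(\<Sum>u\<in>{s<..t}. poly (entry \<kappa> s u) 1 * poly (entry \<kappa> u t) 1) =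
          (\<Sum>u\<in>{s<..t}. if u = t then poly (entry \<kappa> s t) 1 else 0)"
        using step.IH by (intro sum.cong) (auto simp: k(2))
      also have "\<dots> = poly (entry \<kappa> s t) 1"
        using finite_half_open_interval[of s t] \<open>s \<noteq> t\<close> step.hyps by simp
      finally show "poly (entry \<kappa> s t) 1 = 0" by simp
    qed
  qed
  with assms(3) show ?thesis by (simp add: poly_eq_0_iff_dvd)
qed

lemma scale_reduced_kernel:
  assumes "weak_rank rk" "is_kernel rk \<kappa>"
  shows "(monom 1 1 - 1) \<odot> reduced_kernel \<kappa> = \<kappa> - monom 1 1 \<odot> 1"
proof (rule incidence_eqI)
  fix s t :: 'a assume le: "s \<le> t"
  have e: "entry (reduced_kernel \<kappa>) s t = (if s = t then - 1 else entry \<kappa> s t div [:- 1, 1:])" for s t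
    by transfer simp
  have x: "monom 1 1 - 1 = [:- 1, 1 :: int:]"
    by (simp add: monom_altdef one_pCons)
  show "entry ((monom 1 1 - 1) \<odot> reduced_kernel \<kappa>) s t = entry (\<kappa> - monom 1 1 \<odot> 1) s t"
  proof (cases "s = t")
    case True
    then show ?thesis by (simp add: e entry_one kernel_diag[OF assms(2)])
  next
    case False
    with le have "[:- 1, 1:] dvd entry \<kappa> s t" by (intro kernel_dvd[OF assms]) simp
    then have "(monom 1 1 - 1) * (entry \<kappa> s t div [:- 1, 1:]) = entry \<kappa> s t"
      unfolding x by (rule dvd_mult_div_cancel)
    with False show ?thesis by (simp add: e entry_one)
  qed
qed

lemma reduced_kernel_chow:
  "reduced_kernel \<kappa> * chow \<kappa> = - 1" "chow \<kappa> * reduced_kernel \<kappa> = - 1"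
proof -
  have "entry (- reduced_kernel \<kappa>) s s = 1" for s
    by transfer simp
  then obtain b where b: "(- reduced_kernel \<kappa>) * b = 1" "b * (- reduced_kernel \<kappa>) = 1"
    using unitriangular_inverse by blast
  then have "inverse_incidence (reduced_kernel \<kappa>) = - b"
    by (intro inverse_incidence_eq) auto
  with b show "reduced_kernel \<kappa> * chow \<kappa> = - 1" "chow \<kappa> * reduced_kernel \<kappa> = - 1"
    by (simp_all add: chow_def minus_equation_iff eq_commute[of 1])
qed

text \<open>The Chow function in the form in which it is used: multiplying \<open>\<kappa>bar H = -1\<close> by
  \<open>x - 1\<close> removes the division in the reduced kernel.\<close>

lemma kernel_chow:
  fixes \<kappa> :: "'a::locally_finite_order incidence"
  assumes "weak_rank rk" "is_kernel rk \<kappa>"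
  shows "\<kappa> * chow \<kappa> = monom 1 1 \<odot> chow \<kappa> + (1 - monom 1 1) \<odot> 1"
    and "chow \<kappa> * \<kappa> = monom 1 1 \<odot> chow \<kappa> + (1 - monom 1 1) \<odot> 1"
proof -
  have k: "\<kappa> = (monom 1 1 - 1) \<odot> reduced_kernel \<kappa> + monom 1 1 \<odot> 1"
    using scale_reduced_kernel[OF assms] by simp
  have m: "(monom 1 1 - 1) \<odot> (- 1) = (1 - monom 1 1) \<odot> (1 :: 'a incidence)"
    by (rule incidence_eqI) (simp add: algebra_simps)
  show "\<kappa> * chow \<kappa> = monom 1 1 \<odot> chow \<kappa> + (1 - monom 1 1) \<odot> 1"
    by (subst k) (simp add: distrib_right reduced_kernel_chow m del: One_nat_def)
  show "chow \<kappa> * \<kappa> = monom 1 1 \<odot> chow \<kappa> + (1 - monom 1 1) \<odot> 1"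
    by (subst (2) k) (simp add: distrib_left reduced_kernel_chow m del: One_nat_def)
qed

section \<open>Kazhdan-Lusztig-Stanley functions\<close>

text \<open>The conditions on a KLS function other than its equation. They are the same on the left and on
  the right, and they are stable under tensor products and inversion.\<close>

definition KLS_shape :: "('a::order \<Rightarrow> 'a \<Rightarrow> int) \<Rightarrow> 'a incidence set" where
  "KLS_shape rk = {a \<in> bounded_incidence rk. (\<forall>s. entry a s s = 1) \<and>
     (\<forall>s t. s < t \<longrightarrow> 2 * int (degree (entry a s t)) < rk s t)}"

lemma KLS_shapeD:
  assumes "a \<in> KLS_shape rk"
  shows KLS_shape_bounded: "a \<in> bounded_incidence rk"
    and KLS_shape_diag: "entry a s s = 1"
    and KLS_shape_degree: "s < t \<Longrightarrow> 2 * int (degree (entry a s t)) < rk s t"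
  using assms by (auto simp: KLS_shape_def)

lemma KLS_shapeI:
  assumes rk: "weak_rank rk" and diag: "\<And>s. entry a s s = 1"
    and deg: "\<And>s t. s < t \<Longrightarrow> 2 * int (degree (entry a s t)) < rk s t"
  shows "a \<in> KLS_shape rk"
proof -
  have "int (degree (entry a s t)) \<le> rk s t" if "s \<le> t" for s t
  proof (cases "s = t")
    case True
    then show ?thesis using diag[of s] weak_rank_refl[OF rk, of s] by simp
  next
    case False
    then show ?thesis using that deg[of s t] by (simp add: less_le)
  qed
  with assms show ?thesis by (simp add: KLS_shape_def bounded_incidence_def)
qed

lemma KLS_shape_degree_le:
  assumes "weak_rank rk" "a \<in> KLS_shape rk" "s \<le> t"
  shows "2 * int (degree (entry a s t)) \<le> rk s t"
  using KLS_shapeD[OF assms(2)] weak_rank_refl[OF assms(1), of s] assms(3)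
  by (cases "s = t") (auto simp: less_le)

lemma KLS_shape_tensor:
  assumes "weak_rank rk1" "weak_rank rk2" "a \<in> KLS_shape rk1" "b \<in> KLS_shape rk2"
  shows "a \<otimes> b \<in> KLS_shape (prod_rank rk1 rk2)"
proof (rule KLS_shapeI)
  show "weak_rank (prod_rank rk1 rk2)" using assms(1,2) by (rule weak_rank_prod)
  show "entry (a \<otimes> b) s s = 1" for s
    by (simp add: KLS_shape_diag[OF assms(3)] KLS_shape_diag[OF assms(4)])
next
  fix s t :: "'a \<times> 'b" assume st: "s < t"
  then have le: "fst s \<le> fst t" "snd s \<le> snd t" and "fst s < fst t \<or> snd s < snd t"
    by (auto simp: less_prod_def less_eq_prod_def less_le_not_le)
  then show "2 * int (degree (entry (a \<otimes> b) s t)) < prod_rank rk1 rk2 s t"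
    using KLS_shape_degree_le[OF assms(1,3) le(1)] KLS_shape_degree_le[OF assms(2,4) le(2)]
      KLS_shape_degree[OF assms(3), of "fst s" "fst t"]
      KLS_shape_degree[OF assms(4), of "snd s" "snd t"]
      degree_mult_le[of "entry a (fst s) (fst t)" "entry b (snd s) (snd t)"]
    by (auto simp: prod_rank_def)
qed

text \<open>Expanding \<open>a b = 1\<close> expresses \<open>b\<^sub>s\<^sub>,\<^sub>t\<close> by products \<open>a\<^sub>s\<^sub>,\<^sub>u b\<^sub>u\<^sub>,\<^sub>t\<close> with \<open>s < u\<close>; as
  ranks add up, the bound on \<open>a\<^sub>s\<^sub>,\<^sub>u\<close> keeps the inequality strict even when \<open>u = t\<close>.\<close>

lemma KLS_shape_inverse:
  assumes rk: "weak_rank rk" and a: "a \<in> KLS_shape rk"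
    and b: "\<And>s. entry b s s = 1" "a * b = 1"
  shows "b \<in> KLS_shape rk"
proof (rule KLS_shapeI[OF rk b(1)])
  fix s t :: 'a assume "s < t"
  then have "s \<le> t" by simp
  then have "s \<noteq> t \<longrightarrow> 2 * int (degree (entry b s t)) < rk s t"
  proof (induction rule: interval_induct)
    case (step s)
    show ?case
    proof
      assume "s \<noteq> t"
      with step.hyps have "0 < rk s t" by (intro weak_rank_pos[OF rk]) simp
      have "2 * degree (entry a s u * entry b u t) < nat (rk s t)" if u: "u \<in> {s<..t}" for u
      proof -
        have "2 * int (degree (entry b u t)) \<le> rk u t"
          using step.IH[of u] u b(1)[of t] weak_rank_refl[OF rk, of t] by (cases "u = t") auto
        then show ?thesis
          using u KLS_shape_degree[OF a, of s u] weak_rank_add[OF rk, of s u t]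
            degree_mult_le[of "entry a s u" "entry b u t"]
          by auto
      qed
      then have "degree (entry a s u * entry b u t) \<le> (nat (rk s t) - 1) div 2"
        if "u \<in> {s<..t}" for u
        using that by fastforce
      then have "degree (\<Sum>u\<in>{s<..t}. entry a s u * entry b u t) \<le> (nat (rk s t) - 1) div 2"
        by (intro degree_sum_le finite_half_open_interval)
      moreover have "entry b s t = - (\<Sum>u\<in>{s<..t}. entry a s u * entry b u t)"
        using arg_cong[OF b(2), of "\<lambda>c. entry c s t"] \<open>s \<noteq> t\<close> KLS_shape_diag[OF a]
        by (simp add: entry_mult_first[OF step.hyps] entry_one eq_neg_iff_add_eq_0)
      ultimately show "2 * int (degree (entry b s t)) < rk s t"
        using \<open>0 < rk s t\<close> by simp
    qed
  qed
  with \<open>s < t\<close> show "2 * int (degree (entry b s t)) < rk s t" by simp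
qed

text \<open>A polynomial antisymmetric under reversal is determined by its lower half, its middle
  coefficient being zero. The cutoff keeps the coefficients of index \<open>i\<close> with \<open>2 i < n\<close>.\<close>

lemma antisymmetric_poly_split:
  assumes "reverse_poly n q = - q"
  shows "reverse_poly n (- poly_cutoff ((n + 1) div 2) q) = q - poly_cutoff ((n + 1) div 2) q"
proof (rule poly_eqI)
  fix j
  have q: "(if j \<le> n then coeff q (n - j) else 0) = - coeff q j"
    using arg_cong[OF assms, of "\<lambda>p. coeff p j"] by (simp add: coeff_reverse_poly)
  consider "n < j" | "2 * j < n" | "2 * j = n" | "n < 2 * j" "j \<le> n" by linarith
  then show "coeff (reverse_poly n (- poly_cutoff ((n + 1) div 2) q)) j =
      coeff (q - poly_cutoff ((n + 1) div 2) q) j"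
    by cases (use q in \<open>auto simp: coeff_reverse_poly coeff_poly_cutoff\<close>)
qed

text \<open>The coefficients of index \<open>j\<close> and \<open>n - j\<close> agree, and one of the two indices exceeds the degree.
  This is what makes KLS functions unique.\<close>

lemma reverse_poly_fixed_low_degree:
  assumes "reverse_poly n p = p" "2 * degree p < n"
  shows "p = 0"
proof (rule poly_eqI)
  fix j
  have "coeff p j = (if j \<le> n then coeff p (n - j) else 0)"
    using arg_cong[OF assms(1), of "\<lambda>p. coeff p j"] by (simp add: coeff_reverse_poly)
  moreover have "degree p < j \<or> degree p < n - j" using assms(2) by linarith
  ultimately show "coeff p j = coeff 0 j" by (auto simp: coeff_eq_0)
qed

text \<open>Write \<open>q\<close> for the part of \<open>(\<kappa> f)\<^sub>s\<^sub>,\<^sub>t\<close> that does not involve \<open>f\<^sub>s\<^sub>,\<^sub>t\<close>. The entry has to solve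
  \<open>f\<^sub>s\<^sub>,\<^sub>t\<^sup>r\<^sup>e\<^sup>v - f\<^sub>s\<^sub>,\<^sub>t = q\<close>, which is possible exactly when \<open>q\<close> is antisymmetric, and then
  \<open>f\<^sub>s\<^sub>,\<^sub>t\<close> is minus the lower half of \<open>q\<close>. Antisymmetry comes from the kernel condition: using the
  equation on the intervals \<open>[u, t]\<close> already treated, \<open>q\<^sup>r\<^sup>e\<^sup>v\<close> becomes the part of
  \<open>\<kappa>\<^sup>r\<^sup>e\<^sup>v (\<kappa> f) = f\<close> with \<open>s < u\<close>, which is \<open>f\<^sub>s\<^sub>,\<^sub>t - (\<kappa> f)\<^sub>s\<^sub>,\<^sub>t = - q\<close>.\<close>

lemma right_KLS_exists:
  fixes \<kappa> :: "'a::locally_finite_order incidence"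
  assumes rk: "weak_rank rk" and kernel: "is_kernel rk \<kappa>"
  obtains f where "f \<in> KLS_shape rk" and "rev_incidence rk f = \<kappa> * f"
proof -
  note k = is_kernelD[OF kernel]
  obtain f where f: "\<And>s. entry f s s = 1"
    "\<And>s t. s < t \<Longrightarrow> entry f s t =
      - poly_cutoff ((nat (rk s t) + 1) div 2) (\<Sum>u\<in>{s<..t}. entry \<kappa> s u * entry f u t)"
    using triangular_solution_exists[of "\<lambda>s t q. - poly_cutoff ((nat (rk s t) + 1) div 2) q" \<kappa>]
    by blast
  have shape: "f \<in> KLS_shape rk"
  proof (rule KLS_shapeI[OF rk f(1)])
    fix s t :: 'a assume st: "s < t"
    have "degree (entry f s t) \<le> (nat (rk s t) - 1) div 2"
      by (rule degree_le) (auto simp: f(2)[OF st] coeff_poly_cutoff)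
    then show "2 * int (degree (entry f s t)) < rk s t"
      using weak_rank_pos[OF rk st] by linarith
  qed
  note bounded = KLS_shape_bounded[OF shape]
  have "rev_incidence rk f = \<kappa> * f"
  proof (rule incidence_eqI)
    fix s t :: 'a assume "s \<le> t"
    then show "entry (rev_incidence rk f) s t = entry (\<kappa> * f) s t"
    proof (induction rule: interval_induct)
      case (step s)
      show ?case
      proof (cases "s = t")
        case True
        then show ?thesis by (simp add: rev_diag[OF rk f(1)] f(1) k(2))
      next
        case False
        with step.hyps have st: "s < t" by simp
        define n where "n = nat (rk s t)"
        define q where "q = (\<Sum>u\<in>{s<..t}. entry \<kappa> s u * entry f u t)"
        have kf: "entry (\<kappa> * f) s t = entry f s t + q"
          by (simp add: entry_mult_first[OF step.hyps] k(2) q_def)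
        have "reverse_poly n q = (\<Sum>u\<in>{s<..t}.
            entry (rev_incidence rk \<kappa>) s u * entry (rev_incidence rk f) u t)"
          unfolding q_def n_def reverse_poly_sum
          by (intro sum.cong refl reverse_entry_mult[OF rk k(1) bounded]) auto
        also have "\<dots> = (\<Sum>u\<in>{s<..t}. entry (rev_incidence rk \<kappa>) s u * entry (\<kappa> * f) u t)"
          by (intro sum.cong refl) (simp add: step.IH)
        also have "\<dots> = entry (rev_incidence rk \<kappa> * (\<kappa> * f)) s t - entry (\<kappa> * f) s t"
          by (simp add: entry_mult_first[OF step.hyps, of "rev_incidence rk \<kappa>"]
              rev_diag[OF rk k(2)])
        also have "\<dots> = - q"
          using k(4) kf by (simp flip: mult.assoc)
        finally have "reverse_poly n q = - q" .
        then show ?thesis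
          unfolding kf using antisymmetric_poly_split[of n q]
          by (simp add: entry_rev f(2)[OF st] flip: n_def q_def)
      qed
    qed
  qed
  with shape that show ?thesis by blast
qed

lemma right_KLS_unique:
  fixes \<kappa> :: "'a::locally_finite_order incidence"
  assumes rk: "weak_rank rk" and k: "\<And>s. entry \<kappa> s s = 1"
    and f: "f \<in> KLS_shape rk" "rev_incidence rk f = \<kappa> * f"
    and f': "f' \<in> KLS_shape rk" "rev_incidence rk f' = \<kappa> * f'"
  shows "f = f'"
proof (rule incidence_eqI)
  fix s t :: 'a assume "s \<le> t"
  then show "entry f s t = entry f' s t"
  proof (induction rule: interval_induct)
    case (step s)
    show ?case
    proof (cases "s = t")
      case True
      then show ?thesis by (simp add: KLS_shape_diag[OF f(1)] KLS_shape_diag[OF f'(1)])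
    next
      case False
      with step.hyps have st: "s < t" by simp
      define n where "n = nat (rk s t)"
      define d where "d = entry f s t - entry f' s t"
      have "(\<Sum>u\<in>{s<..t}. entry \<kappa> s u * entry f u t) = (\<Sum>u\<in>{s<..t}. entry \<kappa> s u * entry f' u t)"
        by (intro sum.cong refl) (simp add: step.IH)
      then have "entry (\<kappa> * f) s t - entry (\<kappa> * f') s t = d"
        by (simp add: entry_mult_first[OF step.hyps] k d_def)
      then have "reverse_poly n (entry f s t) - reverse_poly n (entry f' s t) = d"
        unfolding f(2)[symmetric] f'(2)[symmetric] by (simp add: entry_rev n_def)
      then have "reverse_poly n d = d"
        using reverse_poly_add[of n d "entry f' s t"] by (simp add: d_def algebra_simps)
      moreover have "2 * degree d < n"
        using KLS_shape_degree[OF f(1) st] KLS_shape_degree[OF f'(1) st]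
          degree_diff_le_max[of "entry f s t" "entry f' s t"]
        by (auto simp: d_def n_def)
      ultimately have "d = 0" by (rule reverse_poly_fixed_low_degree)
      then show ?thesis by (simp add: d_def)
    qed
  qed
qed

text \<open>Inversion exchanges left and right: as \<open>rev\<close> is multiplicative and \<open>\<kappa>\<^sup>-\<^sup>1 = \<kappa>\<^sup>r\<^sup>e\<^sup>v\<close>, inverting
  \<open>g\<^sup>r\<^sup>e\<^sup>v = g \<kappa>\<close> gives \<open>h\<^sup>r\<^sup>e\<^sup>v = \<kappa>\<^sup>r\<^sup>e\<^sup>v h\<close> for \<open>h = g\<^sup>-\<^sup>1\<close>. This reduces the left theory to the
  right one for the kernel \<open>\<kappa>\<^sup>r\<^sup>e\<^sup>v\<close>, without passing to the dual poset.\<close>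

lemma left_KLS_iff_inverse_right_KLS:
  fixes \<kappa> :: "'a::locally_finite_order incidence"
  assumes rk: "weak_rank rk" and kernel: "is_kernel rk \<kappa>"
    and "g \<in> KLS_shape rk" "h \<in> KLS_shape rk" and inv: "g * h = 1" "h * g = 1"
  shows "rev_incidence rk g = g * \<kappa> \<longleftrightarrow> rev_incidence rk h = rev_incidence rk \<kappa> * h"
proof -
  note k = kernel_rev[OF kernel]
  have "rev_incidence rk (g * h) = rev_incidence rk g * rev_incidence rk h"
    "rev_incidence rk (h * g) = rev_incidence rk h * rev_incidence rk g"
    by (intro rev_mult[OF rk] KLS_shape_bounded assms)+
  then have rev_inv: "rev_incidence rk g * rev_incidence rk h = 1"
    "rev_incidence rk h * rev_incidence rk g = 1"
    by (simp_all add: inv rev_one[OF rk])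
  have inv': "(g * \<kappa>) * (rev_incidence rk \<kappa> * h) = 1" "(rev_incidence rk \<kappa> * h) * (g * \<kappa>) = 1"
    using inv k by (metis mult.assoc mult_1_left)+
  show ?thesis
    using inverse_incidence_eq[OF rev_inv] inverse_incidence_eq[OF inv']
      inverse_incidence_eq[OF rev_inv(2,1)] inverse_incidence_eq[OF inv'(2,1)]
    by metis
qed

lemma KLS_shape_inverse_exists:
  assumes "weak_rank rk" "a \<in> KLS_shape rk"
  obtains b where "b \<in> KLS_shape rk" "a * b = 1" "b * a = 1"
proof -
  obtain b where "\<And>s. entry b s s = 1" "a * b = 1" "b * a = 1"
    using unitriangular_inverse[of a] KLS_shape_diag[OF assms(2)] by blast
  with KLS_shape_inverse[OF assms] that show ?thesis by blast
qed

lemma left_KLS_exists: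
  fixes \<kappa> :: "'a::locally_finite_order incidence"
  assumes "weak_rank rk" "is_kernel rk \<kappa>"
  obtains g where "g \<in> KLS_shape rk" and "rev_incidence rk g = g * \<kappa>"
proof -
  obtain h where h: "h \<in> KLS_shape rk" "rev_incidence rk h = rev_incidence rk \<kappa> * h"
    using right_KLS_exists[OF assms(1) kernel_rev_incidence[OF assms]] by blast
  obtain g where "g \<in> KLS_shape rk" "h * g = 1" "g * h = 1"
    using KLS_shape_inverse_exists[OF assms(1) h(1)] by blast
  with h that left_KLS_iff_inverse_right_KLS[OF assms] show ?thesis by blast
qed

lemma left_KLS_unique:
  fixes \<kappa> :: "'a::locally_finite_order incidence"
  assumes rk: "weak_rank rk" and kernel: "is_kernel rk \<kappa>"
    and g: "g \<in> KLS_shape rk" "rev_incidence rk g = g * \<kappa>"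
    and g': "g' \<in> KLS_shape rk" "rev_incidence rk g' = g' * \<kappa>"
  shows "g = g'"
proof -
  obtain h where h: "h \<in> KLS_shape rk" "g * h = 1" "h * g = 1"
    using KLS_shape_inverse_exists[OF rk g(1)] by blast
  obtain h' where h': "h' \<in> KLS_shape rk" "g' * h' = 1" "h' * g' = 1"
    using KLS_shape_inverse_exists[OF rk g'(1)] by blast
  have "rev_incidence rk h = rev_incidence rk \<kappa> * h"
    "rev_incidence rk h' = rev_incidence rk \<kappa> * h'"
    using left_KLS_iff_inverse_right_KLS[OF rk kernel] g g' h h' by blast+
  then have "h = h'"
    using right_KLS_unique[OF rk kernel_diag[OF kernel_rev_incidence[OF rk kernel]]] h(1) h'(1)
    by blast
  with h h' show ?thesis by (metis inverse_incidence_eq)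
qed

lemma right_KLS_eq:
  assumes "weak_rank rk" "is_kernel rk \<kappa>" "f \<in> KLS_shape rk" "rev_incidence rk f = \<kappa> * f"
  shows "right_KLS rk \<kappa> = f"
  unfolding right_KLS_def
proof (rule the_equality)
  show "f' = f" if "f' \<in> bounded_incidence rk \<and> (\<forall>s. entry f' s s = 1) \<and>
      (\<forall>s t. s < t \<longrightarrow> 2 * int (degree (entry f' s t)) < rk s t) \<and>
      rev_incidence rk f' = \<kappa> * f'" for f'
    using right_KLS_unique[OF assms(1) kernel_diag[OF assms(2)] _ _ assms(3,4), of f'] that
    by (simp add: KLS_shape_def)
qed (use assms(3,4) in \<open>simp add: KLS_shape_def\<close>)

lemma left_KLS_eq:
  assumes "weak_rank rk" "is_kernel rk \<kappa>" "g \<in> KLS_shape rk" "rev_incidence rk g = g * \<kappa>"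
  shows "left_KLS rk \<kappa> = g"
  unfolding left_KLS_def
proof (rule the_equality)
  show "g' = g" if "g' \<in> bounded_incidence rk \<and> (\<forall>s. entry g' s s = 1) \<and>
      (\<forall>s t. s < t \<longrightarrow> 2 * int (degree (entry g' s t)) < rk s t) \<and>
      rev_incidence rk g' = g' * \<kappa>" for g'
    using left_KLS_unique[OF assms(1,2) _ _ assms(3,4), of g'] that
    by (simp add: KLS_shape_def)
qed (use assms(3,4) in \<open>simp add: KLS_shape_def\<close>)

lemma rev_right_KLS_tensor:
  assumes rk: "weak_rank rk1" "weak_rank rk2" and kernel: "is_kernel rk1 \<kappa>1" "is_kernel rk2 \<kappa>2"
  shows "rev_incidence (prod_rank rk1 rk2) (right_KLS (prod_rank rk1 rk2) (\<kappa>1 \<otimes> \<kappa>2)) =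
    rev_incidence rk1 (right_KLS rk1 \<kappa>1) \<otimes> rev_incidence rk2 (right_KLS rk2 \<kappa>2)"
proof -
  obtain f1 where f1: "f1 \<in> KLS_shape rk1" "rev_incidence rk1 f1 = \<kappa>1 * f1"
    using right_KLS_exists[OF rk(1) kernel(1)] by blast
  obtain f2 where f2: "f2 \<in> KLS_shape rk2" "rev_incidence rk2 f2 = \<kappa>2 * f2"
    using right_KLS_exists[OF rk(2) kernel(2)] by blast
  have rev: "rev_incidence (prod_rank rk1 rk2) (f1 \<otimes> f2) =
      rev_incidence rk1 f1 \<otimes> rev_incidence rk2 f2"
    by (intro rev_tensor rk KLS_shape_bounded f1 f2)
  have "right_KLS (prod_rank rk1 rk2) (\<kappa>1 \<otimes> \<kappa>2) = f1 \<otimes> f2"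
    by (intro right_KLS_eq weak_rank_prod kernel_tensor KLS_shape_tensor rk kernel f1 f2)
      (simp add: rev f1(2) f2(2) tensor_mult)
  with rev show ?thesis
    by (simp add: right_KLS_eq[OF rk(1) kernel(1) f1] right_KLS_eq[OF rk(2) kernel(2) f2])
qed

lemma rev_left_KLS_tensor:
  assumes rk: "weak_rank rk1" "weak_rank rk2" and kernel: "is_kernel rk1 \<kappa>1" "is_kernel rk2 \<kappa>2"
  shows "rev_incidence (prod_rank rk1 rk2) (left_KLS (prod_rank rk1 rk2) (\<kappa>1 \<otimes> \<kappa>2)) =
    rev_incidence rk1 (left_KLS rk1 \<kappa>1) \<otimes> rev_incidence rk2 (left_KLS rk2 \<kappa>2)"
proof -
  obtain g1 where g1: "g1 \<in> KLS_shape rk1" "rev_incidence rk1 g1 = g1 * \<kappa>1"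
    using left_KLS_exists[OF rk(1) kernel(1)] by blast
  obtain g2 where g2: "g2 \<in> KLS_shape rk2" "rev_incidence rk2 g2 = g2 * \<kappa>2"
    using left_KLS_exists[OF rk(2) kernel(2)] by blast
  have rev: "rev_incidence (prod_rank rk1 rk2) (g1 \<otimes> g2) =
      rev_incidence rk1 g1 \<otimes> rev_incidence rk2 g2"
    by (intro rev_tensor rk KLS_shape_bounded g1 g2)
  have "left_KLS (prod_rank rk1 rk2) (\<kappa>1 \<otimes> \<kappa>2) = g1 \<otimes> g2"
    by (intro left_KLS_eq weak_rank_prod kernel_tensor KLS_shape_tensor rk kernel g1 g2)
      (simp add: rev g1(2) g2(2) tensor_mult)
  with rev show ?thesis
    by (simp add: left_KLS_eq[OF rk(1) kernel(1) g1] left_KLS_eq[OF rk(2) kernel(2) g2])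
qed

section \<open>Products of Chow functions\<close>

text \<open>The element \<open>E\<close> below is the coefficient with which \<open>F\<close> enters the identity of the theorem
  once all its terms are moved to one side. By \<open>kernel_chow\<close> and the multiplicativity of the
  tensor product, \<open>(H\<^sub>1 \<otimes> H\<^sub>2) \<kappa> = (x H\<^sub>1 + (1 - x)) \<otimes> (x H\<^sub>2 + (1 - x))\<close>; after subtracting
  \<open>x (H\<^sub>1 \<otimes> H\<^sub>2)\<close>, every coefficient is divisible by \<open>1 - x\<close> because
  \<open>x\<^sup>2 - x = - x (1 - x)\<close>.\<close>

lemma chow_tensor_reduced_kernel:
  fixes \<kappa>1 :: "'a::locally_finite_order incidence" and \<kappa>2 :: "'b::locally_finite_order incidence"
  assumes rk: "weak_rank rk1" "weak_rank rk2" and kernel: "is_kernel rk1 \<kappa>1" "is_kernel rk2 \<kappa>2"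
  defines "x \<equiv> monom 1 1 :: int poly"
  defines "E \<equiv> 1 - x \<odot> (chow \<kappa>1 \<otimes> chow \<kappa>2) + x \<odot> (1 \<otimes> chow \<kappa>2) + x \<odot> (chow \<kappa>1 \<otimes> 1) - x \<odot> 1"
  shows "(chow \<kappa>1 \<otimes> chow \<kappa>2) * reduced_kernel (\<kappa>1 \<otimes> \<kappa>2) = - E"
    and "reduced_kernel (\<kappa>1 \<otimes> \<kappa>2) * (chow \<kappa>1 \<otimes> chow \<kappa>2) = - E"
proof -
  let ?H = "chow \<kappa>1 \<otimes> chow \<kappa>2" and ?R = "reduced_kernel (\<kappa>1 \<otimes> \<kappa>2)"
  have nz: "x - 1 \<noteq> 0"
    by (simp add: x_def monom_altdef one_pCons)
  have red: "(x - 1) \<odot> ?R = \<kappa>1 \<otimes> \<kappa>2 - x \<odot> 1"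
    unfolding x_def
    by (rule scale_reduced_kernel[OF weak_rank_prod[OF rk] kernel_tensor[OF rk kernel]])
  have expand: "(x \<odot> chow \<kappa>1 + (1 - x) \<odot> 1) \<otimes> (x \<odot> chow \<kappa>2 + (1 - x) \<odot> 1) - x \<odot> ?H
      = (x - 1) \<odot> (- E)"
    unfolding E_def
    by (rule incidence_eqI, unfold tensor_one[symmetric]) (simp add: algebra_simps)
  have "(x - 1) \<odot> (?H * ?R) = ?H * ((x - 1) \<odot> ?R)" by simp
  also have "\<dots> = (chow \<kappa>1 * \<kappa>1) \<otimes> (chow \<kappa>2 * \<kappa>2) - x \<odot> ?H"
    unfolding red by (simp add: right_diff_distrib tensor_mult)
  also have "\<dots> = (x - 1) \<odot> (- E)"
    using kernel_chow(2)[OF rk(1) kernel(1)] kernel_chow(2)[OF rk(2) kernel(2)] expand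
    by (simp add: x_def)
  finally show "?H * ?R = - E" using nz by (rule scale_left_cancel)
  have "(x - 1) \<odot> (?R * ?H) = ((x - 1) \<odot> ?R) * ?H" by simp
  also have "\<dots> = (\<kappa>1 * chow \<kappa>1) \<otimes> (\<kappa>2 * chow \<kappa>2) - x \<odot> ?H"
    unfolding red by (simp add: left_diff_distrib tensor_mult)
  also have "\<dots> = (x - 1) \<odot> (- E)"
    using kernel_chow(1)[OF rk(1) kernel(1)] kernel_chow(1)[OF rk(2) kernel(2)] expand
    by (simp add: x_def)
  finally show "?R * ?H = - E" using nz by (rule scale_left_cancel)
qed

theorem theorem4p4:
  fixes rk1 :: "'a::locally_finite_order \<Rightarrow> 'a \<Rightarrow> int"
    and rk2 :: "'b::locally_finite_order \<Rightarrow> 'b \<Rightarrow> int"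
    and \<kappa>1 H1 F1 G1 :: "'a incidence"
    and \<kappa>2 H2 F2 G2 :: "'b incidence"
    and rk :: "'a \<times> 'b \<Rightarrow> 'a \<times> 'b \<Rightarrow> int"
    and \<kappa> F G :: "('a \<times> 'b) incidence"
    and x :: "int poly"
  assumes "weak_rank rk1" and "weak_rank rk2"
    and "is_kernel rk1 \<kappa>1" and "is_kernel rk2 \<kappa>2"
  defines "x \<equiv> monom 1 1"
    and "rk \<equiv> prod_rank rk1 rk2"
    and "\<kappa> \<equiv> \<kappa>1 \<otimes> \<kappa>2"
    and "H1 \<equiv> chow \<kappa>1" and "H2 \<equiv> chow \<kappa>2"
    and "F1 \<equiv> right_augmented_chow rk1 \<kappa>1" and "F2 \<equiv> right_augmented_chow rk2 \<kappa>2"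
    and "F \<equiv> right_augmented_chow rk \<kappa>"
    and "G1 \<equiv> left_augmented_chow rk1 \<kappa>1" and "G2 \<equiv> left_augmented_chow rk2 \<kappa>2"
    and "G \<equiv> left_augmented_chow rk \<kappa>"
  shows "F = F1 \<otimes> F2 + x \<odot> ((H1 \<otimes> H2) * F) - x \<odot> ((1 \<otimes> H2) * F)
           - x \<odot> ((H1 \<otimes> 1) * F) + x \<odot> F \<and>
         G = G1 \<otimes> G2 + x \<odot> (G * (H1 \<otimes> H2)) - x \<odot> (G * (1 \<otimes> H2))
           - x \<odot> (G * (H1 \<otimes> 1)) + x \<odot> G"
proof
  let ?R = "reduced_kernel \<kappa>" and ?H = "H1 \<otimes> H2"
  let ?E = "1 - x \<odot> ?H + x \<odot> (1 \<otimes> H2) + x \<odot> (H1 \<otimes> 1) - x \<odot> 1"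
  note assms' = assms(1-4)
  have E: "?H * ?R = - ?E" "?R * ?H = - ?E"
    using chow_tensor_reduced_kernel[OF assms']
    unfolding x_def H1_def H2_def \<kappa>_def by simp_all

  let ?f = "rev_incidence rk (right_KLS rk \<kappa>)"
  have "F1 \<otimes> F2 = ?H * ?f"
    unfolding F1_def F2_def H1_def H2_def right_augmented_chow_def rk_def \<kappa>_def
      rev_right_KLS_tensor[OF assms'] tensor_mult ..
  also have "?f = - (?R * F)"
    unfolding F_def right_augmented_chow_def by (simp add: reduced_kernel_chow flip: mult.assoc)
  also have "?H * - (?R * F) = - (?H * ?R) * F"
    by (simp add: mult.assoc)
  also have "\<dots> = ?E * F"
    by (simp only: E minus_minus)
  finally show "F = F1 \<otimes> F2 + x \<odot> (?H * F) - x \<odot> ((1 \<otimes> H2) * F)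
      - x \<odot> ((H1 \<otimes> 1) * F) + x \<odot> F"
    by (simp add: algebra_simps)

  let ?g = "rev_incidence rk (left_KLS rk \<kappa>)"
  have "G1 \<otimes> G2 = ?g * ?H"
    unfolding G1_def G2_def H1_def H2_def left_augmented_chow_def rk_def \<kappa>_def
      rev_left_KLS_tensor[OF assms'] tensor_mult ..
  also have "?g = - (G * ?R)"
    unfolding G_def left_augmented_chow_def by (simp add: reduced_kernel_chow mult.assoc)
  also have "- (G * ?R) * ?H = G * - (?R * ?H)"
    by (simp add: mult.assoc)
  also have "\<dots> = G * ?E"
    by (simp only: E minus_minus)
  finally show "G = G1 \<otimes> G2 + x \<odot> (G * ?H) - x \<odot> (G * (1 \<otimes> H2))
      - x \<odot> (G * (H1 \<otimes> 1)) + x \<odot> G"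
    by (simp add: algebra_simps)
qed

end
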